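(* Let $g(x), f(x)\in\mathcal{F}_0$ with $f(x)$ an even power series (that is, $f(-x)=f(x)$), and let $M(g,f)$ be the infinite matrix with bivariate generating function $$\frac{g(x)}{(1-x)(1+yx)}+\frac{xf(x)}{(1-x^2)(1-yx)}.$$ Then $$M(g,f)^2=\left(\frac{g(x)g(-x)(1-x^2)+x^2 f(x)^2}{(1-x^2)^2},\ x\right),$$ where the array on the right-hand side is an aerated Appell array.
   Context: All power series are formal power series with coefficients in $\mathbb{C}$. For $r\ge 0$, $\mathcal{F}_r=\{\sum_{n\ge r} a_n x^n \in \mathbb{C}[[x]] : a_r\neq 0\}$. The bivariate generating function of an infinite matrix $(t_{n,k})_{n,k\ge 0}$ is $\sum_{n,k\ge 0} t_{n,k}x^n y^k$, and $[x^n]$ denotes extraction of the coefficient of $x^n$. The matrix $M(g,f)$ is lower-triangular, and $M(g,f)^2$ denotes its square under ordinary matrix multiplication. For $u\in\mathcal{F}_0$, the Appell array $(u(x),x)$ is the lower-triangular infinite matrix with entries $t_{n,k}=[x^n]\,u(x)x^k$ for $n,k\ge 0$. It is called an aerated Appell array if $u(x)=h(x^2)$ for some $h\in\mathcal{F}_0$. *)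

theory Defs
  imports
    Complex_Main
    "HOL-Library.Groups_Big_Fun"
    "HOL-Computational_Algebra.Formal_Power_Series"
begin

unbundle fps_syntax

definition fps_order_set :: "nat \<Rightarrow> complex fps set" where
  "fps_order_set r = {a. (\<forall>n<r. a $ n = 0) \<and> a $ r \<noteq> 0}"

type_synonym inf_matrix = "nat \<Rightarrow> nat \<Rightarrow> complex"

(* The sum over all j is taken over the support of the summand, which is finite
   whenever the left factor is row-finite, in particular lower-triangular. *)
definition inf_matrix_mult :: "inf_matrix \<Rightarrow> inf_matrix \<Rightarrow> inf_matrix" where
  "inf_matrix_mult A B = (\<lambda>n k. Sum_any (\<lambda>j. A n j * B j k))"

definition appell_array :: "complex fps \<Rightarrow> inf_matrix" where
  "appell_array u = (\<lambda>n k. (u * fps_X ^ k) $ n)"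

definition aerated_appell_array :: "inf_matrix \<Rightarrow> bool" where
  "aerated_appell_array A \<longleftrightarrow>
     (\<exists>h \<in> fps_order_set 0. A = appell_array (h oo fps_X\<^sup>2))"

(* Bivariate series are elements of C[[y]][[x]]: the coefficient of x^n y^k in F is F $ n $ k. *)
type_synonym bfps = "complex fps fps"

abbreviation vx :: bfps where "vx \<equiv> fps_X"
abbreviation vy :: bfps where "vy \<equiv> fps_const fps_X"

definition in_x :: "complex fps \<Rightarrow> bfps" where
  "in_x a = Abs_fps (\<lambda>n. fps_const (a $ n))"

definition bivariate_gf :: "inf_matrix \<Rightarrow> bfps" where
  "bivariate_gf t = Abs_fps (\<lambda>n. Abs_fps (\<lambda>k. t n k))"

(* The library's division on nested series is total, and the coefficients form no field;
   it is genuine division here because both denominators below have constant coefficient 1. *)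
lemma bfps_divide_mult_cancel:
  fixes a d :: bfps
  assumes "d $ 0 = 1"
  shows "a / d * d = a"
proof -
  have "d * inverse d = 1"
    unfolding fps_inverse_def
    by (rule fps_right_inverse) (simp add: assms fps_inverse_def fps_lr_inverse_one_one)
  moreover have "a / d = a * inverse d"
    using assms by (intro fps_divide_unit) simp
  ultimately show ?thesis
    by (simp add: mult.assoc mult.commute)
qed

lemma M_gf_denominators:
  "((1 - vx) * (1 + vy * vx)) $ 0 = 1"
  "((1 - vx\<^sup>2) * (1 - vy * vx)) $ 0 = 1"
  by simp_all

definition M_gf :: "complex fps \<Rightarrow> complex fps \<Rightarrow> bfps" where
  "M_gf g f = in_x g / ((1 - vx) * (1 + vy * vx))
            + vx * in_x f / ((1 - vx\<^sup>2) * (1 - vy * vx))"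

definition M_array :: "complex fps \<Rightarrow> complex fps \<Rightarrow> inf_matrix" where
  "M_array g f = (\<lambda>n k. M_gf g f $ n $ k)"

lemma bivariate_gf_eq_iff: "bivariate_gf t = M_gf g f \<longleftrightarrow> t = M_array g f"
  by (auto simp: bivariate_gf_def M_array_def fps_eq_iff fun_eq_iff)

end

theory Submission
  imports Defs
begin

text \<open>
  Let a matrix act on a power series by acting on its coefficient vector. Expanding the geometric
  series in \<open>y\<close> shows that column \<open>k\<close> of \<open>M(g,f)\<close> is the series \<open>((-1)\<^sup>k p + q) x\<^sup>k\<close> with
  \<open>p = g / (1 - x)\<close> and \<open>q = x f / (1 - x\<^sup>2)\<close> (\<open>M_array_nth\<close>). Hence \<open>M(g,f)\<close> is the operator
  \<open>a(x) \<mapsto> p(x) a(-x) + q(x) a(x)\<close>. Applying it twice gives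
  \<open>a(x) \<mapsto> (p(x) p(-x) + q(x)\<^sup>2) a(x) + p(x) (q(-x) + q(x)) a(-x)\<close>.
  The series \<open>q\<close> is odd because \<open>f\<close> is even, so the reflected term vanishes, and the square is
  multiplication by \<open>p(x) p(-x) + q(x)\<^sup>2\<close>, that is, the Appell array of this series
  (\<open>M_array_square\<close>). The series is even, so it is a series in \<open>x\<^sup>2\<close>, and its constant term is
  \<open>g(0)\<^sup>2 \<noteq> 0\<close>.
\<close>

abbreviation reflect :: "complex fps \<Rightarrow> complex fps" where
  "reflect a \<equiv> a oo (- fps_X)"

lemma reflect_nth: "reflect a $ n = (- 1) ^ n * a $ n"
  by (simp add: fps_compose_uminus')

lemma reflect_reflect: "reflect (reflect a) = a"
  by (rule fps_ext) (simp add: reflect_nth flip: mult.assoc power_add)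

lemma reflect_mult: "reflect (a * b) = reflect a * reflect b"
  by (rule fps_compose_mult_distrib) simp

lemma reflect_X_power: "reflect (fps_X ^ k) = (- 1) ^ k * fps_X ^ k"
  by (simp add: fps_compose_power[symmetric] power_minus[of fps_X k])

lemma reflect_invariant_is_series_in_X_squared:
  assumes "reflect u = u"
  shows "Abs_fps (\<lambda>n. u $ (2 * n)) oo fps_X\<^sup>2 = u"
proof (rule fps_ext)
  fix n
  have odd: "u $ n = 0" if "odd n"
    using that reflect_nth[of u n] assms by simp
  have "(Abs_fps (\<lambda>n. u $ (2 * n)) oo fps_X\<^sup>2) $ n
      = (\<Sum>i = 0..n. if n = 2 * i then u $ n else 0)"
    unfolding fps_compose_nth by (intro sum.cong) (auto simp flip: power_mult)
  also have "\<dots> = u $ n"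
  proof (cases "even n")
    case True
    then obtain m where "n = 2 * m" ..
    then show ?thesis by simp
  next
    case False
    then show ?thesis using odd by (auto intro!: sum.neutral)
  qed
  finally show "(Abs_fps (\<lambda>n. u $ (2 * n)) oo fps_X\<^sup>2) $ n = u $ n" .
qed

lemma aerated_appell_array_if_reflect_invariant:
  assumes "reflect u = u" and "u $ 0 \<noteq> 0"
  shows "aerated_appell_array (appell_array u)"
  unfolding aerated_appell_array_def
proof (rule bexI)
  show "appell_array u = appell_array (Abs_fps (\<lambda>n. u $ (2 * n)) oo fps_X\<^sup>2)"
    using assms(1) by (simp add: reflect_invariant_is_series_in_X_squared)
  show "Abs_fps (\<lambda>n. u $ (2 * n)) \<in> fps_order_set 0"
    using assms(2) by (simp add: fps_order_set_def)
qed

lemma fps_const_sum: "fps_const (\<Sum>i\<in>I. c i) = (\<Sum>i\<in>I. fps_const (c i))"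
  by (rule fps_ext) (simp add: fps_sum_nth)

lemma in_x_mult: "in_x (a * b) = in_x a * in_x b"
  by (rule fps_ext) (simp add: in_x_def fps_mult_nth fps_const_sum)

lemma in_x_X: "in_x fps_X = vx"
  by (rule fps_ext) (simp add: in_x_def fps_X_def)

lemma in_x_1: "in_x 1 = 1"
  by (rule fps_ext) (simp add: in_x_def)

lemma in_x_diff: "in_x (a - b) = in_x a - in_x b"
  by (rule fps_ext) (simp add: in_x_def)

text \<open>The series \<open>1 / (1 - s x y)\<close>.\<close>

definition geometric_xy :: "complex \<Rightarrow> bfps" where
  "geometric_xy s = Abs_fps (\<lambda>n. fps_const (s ^ n) * fps_X ^ n)"

lemma geometric_xy_inverse:
  "geometric_xy s * (1 - fps_const (fps_const s) * vy * vx) = 1"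
proof (rule fps_ext)
  fix n
  have "(geometric_xy s * (1 - fps_const (fps_const s) * vy * vx)) $ n
      = geometric_xy s $ n - (geometric_xy s * fps_const (fps_const s * fps_X) * vx) $ n"
    by (simp add: algebra_simps)
  also have "\<dots> = (1 :: bfps) $ n"
    by (cases n) (simp_all add: geometric_xy_def algebra_simps flip: fps_const_mult)
  finally show "(geometric_xy s * (1 - fps_const (fps_const s) * vy * vx)) $ n = (1 :: bfps) $ n" .
qed

lemma in_x_mult_geometric_xy_nth:
  "(in_x a * geometric_xy s) $ n $ k = s ^ k * (a * fps_X ^ k) $ n"
proof -
  have "(in_x a * geometric_xy s) $ n $ k
      = (\<Sum>i = 0..n. if i = n - k \<and> k \<le> n then s ^ k * a $ (n - k) else 0)"
    unfolding fps_mult_nth[of "in_x a"] fps_sum_nth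
    by (intro sum.cong) (auto simp: in_x_def geometric_xy_def)
  then show ?thesis
    by (simp add: fps_X_power_mult_right_nth)
qed

lemma bfps_divide_eqI:
  fixes a b d :: bfps
  assumes "d $ 0 = 1" and "b * d = a"
  shows "a / d = b"
proof -
  have "d \<noteq> 0"
    using assms(1) by auto
  moreover have "a / d * d = b * d"
    using bfps_divide_mult_cancel[OF assms(1)] assms(2) by simp
  ultimately show ?thesis
    by simp
qed

text \<open>
  The factors \<open>1 / (1 + y x)\<close> and \<open>1 / (1 - y x)\<close> carry the whole dependence on \<open>y\<close>; the
  coefficients of \<open>y\<^sup>k\<close> in them are \<open>(-x)\<^sup>k\<close> and \<open>x\<^sup>k\<close>.
\<close>

lemma M_array_nth:
  assumes "p * (1 - fps_X) = g" and "q * (1 - fps_X\<^sup>2) = fps_X * f"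
  shows "M_array g f n k = (- 1) ^ k * (p * fps_X ^ k) $ n + (q * fps_X ^ k) $ n"
proof -
  have g: "in_x p * (1 - vx) = in_x g"
    using arg_cong[OF assms(1), of in_x] by (simp add: in_x_mult in_x_diff in_x_1 in_x_X)
  have f: "in_x q * (1 - vx\<^sup>2) = vx * in_x f"
    using arg_cong[OF assms(2), of in_x]
    by (simp add: in_x_mult in_x_diff in_x_1 in_x_X power2_eq_square)
  have minus: "geometric_xy (- 1) * (1 + vy * vx) = 1"
    using geometric_xy_inverse[of "- 1"] by (simp flip: fps_const_neg)
  have plus: "geometric_xy 1 * (1 - vy * vx) = 1"
    using geometric_xy_inverse[of 1] by simp
  have "in_x g / ((1 - vx) * (1 + vy * vx)) = in_x p * geometric_xy (- 1)"
  proof (rule bfps_divide_eqI[OF M_gf_denominators(1)])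
    have "in_x p * geometric_xy (- 1) * ((1 - vx) * (1 + vy * vx))
        = (in_x p * (1 - vx)) * (geometric_xy (- 1) * (1 + vy * vx))"
      by (simp only: ac_simps)
    then show "in_x p * geometric_xy (- 1) * ((1 - vx) * (1 + vy * vx)) = in_x g"
      by (simp only: g minus mult_1_right)
  qed
  moreover have "vx * in_x f / ((1 - vx\<^sup>2) * (1 - vy * vx)) = in_x q * geometric_xy 1"
  proof (rule bfps_divide_eqI[OF M_gf_denominators(2)])
    have "in_x q * geometric_xy 1 * ((1 - vx\<^sup>2) * (1 - vy * vx))
        = (in_x q * (1 - vx\<^sup>2)) * (geometric_xy 1 * (1 - vy * vx))"
      by (simp only: ac_simps)
    then show "in_x q * geometric_xy 1 * ((1 - vx\<^sup>2) * (1 - vy * vx)) = vx * in_x f"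
      by (simp only: f plus mult_1_right)
  qed
  ultimately show ?thesis
    by (simp add: M_array_def M_gf_def in_x_mult_geometric_xy_nth)
qed

text \<open>
  Multiplying a matrix on the right by a column vector is linear, and the matrix whose column
  \<open>j\<close> is \<open>((-1)\<^sup>j p + q) x\<^sup>j\<close> sends \<open>x\<^sup>j\<close> to \<open>p (-x)\<^sup>j + q x\<^sup>j\<close>.
  Column \<open>j\<close> is divisible by \<open>x\<^sup>j\<close>, so only the indices \<open>j \<le> n\<close> contribute to row \<open>n\<close>.
\<close>

lemma Sum_any_signed_columns:
  assumes "\<And>n j. T n j = (- 1) ^ j * (p * fps_X ^ j) $ n + (q * fps_X ^ j) $ n"
  shows "Sum_any (\<lambda>j. T n j * a $ j) = (p * reflect a + q * a) $ n"
proof -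
  have "Sum_any (\<lambda>j. T n j * a $ j) = (\<Sum>j = 0..n. T n j * a $ j)"
    by (rule Sum_any.expand_superset) (auto simp: assms fps_X_power_mult_right_nth)
  also have "\<dots> = (\<Sum>j = 0..n. reflect a $ j * p $ (n - j) + a $ j * q $ (n - j))"
    by (intro sum.cong) (auto simp: assms fps_X_power_mult_right_nth reflect_nth algebra_simps)
  also have "\<dots> = (reflect a * p + a * q) $ n"
    by (simp add: fps_mult_nth sum.distrib)
  finally show ?thesis
    by (simp add: mult.commute)
qed

lemma M_array_square:
  assumes p: "p * (1 - fps_X) = g" and q: "q * (1 - fps_X\<^sup>2) = fps_X * f"
    and odd: "reflect q = - q"
  shows "inf_matrix_mult (M_array g f) (M_array g f) = appell_array (p * reflect p + q\<^sup>2)"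
proof (intro ext)
  fix n k
  define c where "c = p * reflect (fps_X ^ k) + q * fps_X ^ k"
  have column: "M_array g f j k = c $ j" for j
    by (cases "even k") (simp_all add: M_array_nth[OF p q] c_def reflect_X_power)
  \<comment> \<open>Because \<open>q\<close> is odd, \<open>p(x) q(x) (-x)\<^sup>k\<close> arises twice, with opposite signs.\<close>
  have "reflect c = reflect p * fps_X ^ k - q * reflect (fps_X ^ k)"
    by (simp add: c_def fps_compose_add_distrib reflect_mult reflect_reflect odd)
  then have "p * reflect c + q * c
      = p * (reflect p * fps_X ^ k - q * reflect (fps_X ^ k)) + q * c"
    by (rule arg_cong)
  also have "\<dots> = (p * reflect p + q\<^sup>2) * fps_X ^ k"
    by (simp add: c_def algebra_simps power2_eq_square)
  finally show "inf_matrix_mult (M_array g f) (M_array g f) n k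
      = appell_array (p * reflect p + q\<^sup>2) n k"
    using Sum_any_signed_columns[OF M_array_nth[OF p q], of n c]
    by (simp add: inf_matrix_mult_def appell_array_def column)
qed

theorem proposition13:
  fixes g f :: "complex fps"
  assumes "g \<in> fps_order_set 0" and "f \<in> fps_order_set 0"
    and "f oo (- fps_X) = f"
  shows "let A = appell_array
               ((g * (g oo (- fps_X)) * (1 - fps_X\<^sup>2) + fps_X\<^sup>2 * f\<^sup>2) / (1 - fps_X\<^sup>2)\<^sup>2)
         in inf_matrix_mult (M_array g f) (M_array g f) = A \<and> aerated_appell_array A"
proof -
  define p where "p = g / (1 - fps_X)"
  define q where "q = fps_X * f / (1 - fps_X\<^sup>2)"
  define u where "u = p * reflect p + q\<^sup>2"
  let ?d = "1 - fps_X\<^sup>2 :: complex fps"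
  have d0: "?d \<noteq> 0"
    by (rule fps_nonzeroI[of _ 0]) simp
  have p: "p * (1 - fps_X) = g"
    unfolding p_def by (rule dvd_div_mult_self) (simp add: fps_dvd_iff)
  have q: "q * ?d = fps_X * f"
    unfolding q_def by (rule dvd_div_mult_self) simp
  have reflect_p: "reflect p * (1 + fps_X) = reflect g"
    using arg_cong[OF p, of reflect] by (simp add: reflect_mult fps_compose_sub_distrib)
  have "reflect q * ?d = - (fps_X * f)"
    using arg_cong[OF q, of reflect] assms(3)
    by (simp add: reflect_mult fps_compose_sub_distrib reflect_X_power)
  then have "reflect q * ?d = - q * ?d"
    using q by simp
  then have odd: "reflect q = - q"
    using d0 by (metis mult_right_cancel)
  have even: "reflect u = u"
    by (simp add: u_def fps_compose_add_distrib reflect_mult reflect_reflect odd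
        power2_eq_square mult.commute)
  have "u * ?d\<^sup>2 = (p * (1 - fps_X)) * (reflect p * (1 + fps_X)) * ?d + (q * ?d)\<^sup>2"
    unfolding u_def by (simp add: algebra_simps power2_eq_square)
  also have "\<dots> = g * reflect g * ?d + fps_X\<^sup>2 * f\<^sup>2"
    by (simp only: p q reflect_p power_mult_distrib)
  finally have "(g * reflect g * ?d + fps_X\<^sup>2 * f\<^sup>2) / ?d\<^sup>2 = u"
    using d0 by (metis nonzero_mult_div_cancel_right power_not_zero)
  moreover have "u $ 0 \<noteq> 0"
  proof -
    have "p $ 0 = g $ 0"
      using arg_cong[OF p, of "\<lambda>a. a $ 0"] by simp
    moreover have "q $ 0 = 0"
      using arg_cong[OF q, of "\<lambda>a. a $ 0"] by simp
    ultimately show ?thesis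
      using assms(1) by (simp add: u_def reflect_nth fps_order_set_def power2_eq_square)
  qed
  ultimately show ?thesis
    using M_array_square[OF p q odd] aerated_appell_array_if_reflect_invariant[OF even]
    by (simp add: u_def Let_def)
qed

end
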